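(* Let $R$ be a nonzero commutative ring. Then $R$ is a finite ring that is not a field if and only if $Z(R)$ is a finite set with $Z(R)\neq\{0\}$.
   Context: Rings are commutative with identity. $Z(R)=\{a\in R:\operatorname{Ann}(a)\neq 0\}$ is the set of all zerodivisors of $R$, where $\operatorname{Ann}(a)=\{r\in R: ra=0\}$ (so $0\in Z(R)$ when $R\neq 0$). *)

theory Defs
  imports "HOL-Algebra.Ring"
begin

definition annihilator :: "('a, 'b) ring_scheme \<Rightarrow> 'a \<Rightarrow> 'a set" where
  "annihilator R a = {r \<in> carrier R. r \<otimes>\<^bsub>R\<^esub> a = \<zero>\<^bsub>R\<^esub>}"

text \<open>The set $Z(R)$ of all zerodivisors; \<open>\<zero>\<close> belongs to it when the ring is nonzero.\<close>

definition zerodivisors :: "('a, 'b) ring_scheme \<Rightarrow> 'a set" where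
  "zerodivisors R = {a \<in> carrier R. annihilator R a \<noteq> {\<zero>\<^bsub>R\<^esub>}}"

end

theory Submission
  imports Defs
begin

text \<open>
  Two observations carry the proof. First, for \<open>R\<close> nonzero, \<open>Z(R) = {\<zero>}\<close> says exactly that \<open>R\<close> is a domain,
  and a finite domain is a field because multiplication by a nonzero element is injective,
  hence surjective; this turns ``not a field'' into \<open>Z(R) \<noteq> {\<zero>}\<close> for finite rings.

  Second, a single nonzero zerodivisor \<open>a\<close> controls the size of \<open>R\<close> (Ganesan's argument):
  the map \<open>r \<mapsto> r a\<close> is additive with kernel \<open>Ann(a)\<close> and image \<open>aR\<close>, and both of these sets
  consist of zerodivisors. The first is killed by \<open>a\<close>, the second by any nonzero element of
  \<open>Ann(a)\<close>. If \<open>Z(R)\<close> is finite, the map has finite image and finite fibres, so \<open>R\<close> is finite.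
\<close>

lemma (in cring) zerodivisorI:
  assumes "a \<in> carrier R" "b \<in> carrier R" "b \<noteq> \<zero>" "b \<otimes> a = \<zero>"
  shows "a \<in> zerodivisors R"
  using assms unfolding zerodivisors_def annihilator_def by blast

lemma (in cring) zerodivisorE:
  assumes "a \<in> zerodivisors R"
  obtains b where "a \<in> carrier R" "b \<in> carrier R" "b \<noteq> \<zero>" "b \<otimes> a = \<zero>"
  using assms unfolding zerodivisors_def annihilator_def by auto

lemma (in cring) zero_in_zerodivisors:
  assumes "carrier R \<noteq> {\<zero>}"
  shows "\<zero> \<in> zerodivisors R"
  using assms zerodivisorI[of \<zero> \<one>] carrier_one_zero by auto

lemma (in cring) zerodivisors_trivial_iff_domain:
  assumes "carrier R \<noteq> {\<zero>}"
  shows "zerodivisors R = {\<zero>} \<longleftrightarrow> domain R"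
proof
  assume trivial: "zerodivisors R = {\<zero>}"
  show "domain R"
  proof (rule domain.intro[OF is_cring], unfold_locales)
    show "\<one> \<noteq> \<zero>"
      using assms carrier_one_zero by auto
  next
    fix a b
    assume "a \<otimes> b = \<zero>" "a \<in> carrier R" "b \<in> carrier R"
    then show "a = \<zero> \<or> b = \<zero>"
      using zerodivisorI[of b a] trivial by auto
  qed
next
  assume "domain R"
  then have "zerodivisors R \<subseteq> {\<zero>}"
    by (auto elim!: zerodivisorE dest: domain.integral)
  then show "zerodivisors R = {\<zero>}"
    using zero_in_zerodivisors[OF assms] by blast
qed

lemma (in domain) finite_imp_field:
  assumes "finite (carrier R)"
  shows "field R"
proof (rule cring_fieldI2)
  show "\<zero> \<noteq> \<one>" by simp
next
  fix a
  assume a: "a \<in> carrier R" "a \<noteq> \<zero>"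
  have "inj_on (\<lambda>r. a \<otimes> r) (carrier R)"
    using a by (intro inj_onI) (simp add: m_lcancel)
  then have "(\<lambda>r. a \<otimes> r) ` carrier R = carrier R"
    using a by (intro endo_inj_surj[OF assms]) auto
  then show "\<exists>b\<in>carrier R. a \<otimes> b = \<one>"
    by (metis imageE one_closed)
qed

text \<open>
  A nonempty fibre of \<open>r \<mapsto> r a\<close> is a translate of \<open>Ann(a)\<close>, which lies inside the
  zerodivisors because \<open>a \<noteq> \<zero>\<close>.
\<close>

lemma (in cring) finite_fibre_of_mult:
  assumes "finite (zerodivisors R)" "a \<in> carrier R" "a \<noteq> \<zero>" "s \<in> carrier R"
  shows "finite {r \<in> carrier R. r \<otimes> a = s \<otimes> a}"
proof (rule finite_subset)
  show "{r \<in> carrier R. r \<otimes> a = s \<otimes> a} \<subseteq> (\<lambda>z. z \<oplus> s) ` zerodivisors R"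
  proof
    fix r
    assume "r \<in> {r \<in> carrier R. r \<otimes> a = s \<otimes> a}"
    then have r: "r \<in> carrier R" "r \<otimes> a = s \<otimes> a" by auto
    have "a \<otimes> (r \<ominus> s) = \<zero>"
      using assms r by (simp add: minus_eq r_distr r_minus r_neg m_comm[of a])
    then have "r \<ominus> s \<in> zerodivisors R"
      using assms r by (intro zerodivisorI[of _ a]) auto
    moreover have "r = (r \<ominus> s) \<oplus> s"
      using assms r by (simp add: minus_eq a_assoc l_neg)
    ultimately show "r \<in> (\<lambda>z. z \<oplus> s) ` zerodivisors R" by blast
  qed
qed (use assms in simp)

lemma (in cring) finite_zerodivisors_imp_finite:
  assumes fin: "finite (zerodivisors R)"
    and a: "a \<in> zerodivisors R" "a \<noteq> \<zero>"
  shows "finite (carrier R)"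
proof (rule ccontr)
  obtain b where b: "a \<in> carrier R" "b \<in> carrier R" "b \<noteq> \<zero>" "b \<otimes> a = \<zero>"
    using a(1) by (rule zerodivisorE)
  have "(\<lambda>r. r \<otimes> a) ` carrier R \<subseteq> zerodivisors R"
  proof (rule image_subsetI)
    fix r
    assume "r \<in> carrier R"
    then show "r \<otimes> a \<in> zerodivisors R"
      using b by (intro zerodivisorI[of _ b]) (simp_all add: m_lcomm[of b])
  qed
  then have "finite ((\<lambda>r. r \<otimes> a) ` carrier R)"
    using fin by (rule finite_subset)
  moreover assume "infinite (carrier R)"
  ultimately obtain s where "s \<in> carrier R" "infinite {r \<in> carrier R. r \<otimes> a = s \<otimes> a}"
    using pigeonhole_infinite by blast
  then show False
    using finite_fibre_of_mult[OF fin b(1) a(2)] by blast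
qed

theorem theorem2p27:
  fixes R :: "('a, 'b) ring_scheme" (structure)
  assumes "cring R"
    and "carrier R \<noteq> {\<zero>}"
  shows "finite (carrier R) \<and> \<not> field R \<longleftrightarrow>
    finite (zerodivisors R) \<and> zerodivisors R \<noteq> {\<zero>}"
proof -
  interpret cring R by fact
  have domain: "zerodivisors R = {\<zero>} \<longleftrightarrow> domain R"
    using assms(2) by (rule zerodivisors_trivial_iff_domain)
  show ?thesis
  proof (intro iffI conjI; elim conjE)
    assume "finite (carrier R)"
    then show "finite (zerodivisors R)"
      by (rule rev_finite_subset) (auto simp: zerodivisors_def)
  next
    assume "finite (carrier R)" "\<not> field R"
    then show "zerodivisors R \<noteq> {\<zero>}"
      using domain domain.finite_imp_field by blast
  next
    assume "finite (zerodivisors R)" "zerodivisors R \<noteq> {\<zero>}"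
    then show "finite (carrier R)"
      using zero_in_zerodivisors[OF assms(2)] finite_zerodivisors_imp_finite by blast
  next
    assume "zerodivisors R \<noteq> {\<zero>}"
    then show "\<not> field R"
      using domain field.axioms(1) by blast
  qed
qed

end
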